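(* Let $\varphi:\mathbb{R}^n\to\mathbb{R}$ be a $\mathcal{C}^{1,1}$-smooth function. If $\varphi$ is pseudoconvex, then for all $x,u\in\mathbb{R}^n$ with $\langle\nabla\varphi(x),u\rangle=0$ one has $\langle z,u\rangle\ge 0$ for all $z\in\widehat\partial^2\varphi(x)(u)$.
   Context: $\mathcal{C}^{1,1}$-smooth: $\varphi$ is Fréchet differentiable on $\mathbb{R}^n$ and its gradient $\nabla\varphi:\mathbb{R}^n\to\mathbb{R}^n$ is locally Lipschitz. Pseudoconvex (for differentiable $\varphi$): for all $x,y\in\mathbb{R}^n$, $\varphi(x)>\varphi(y)$ implies $\langle\nabla\varphi(x),y-x\rangle<0$. For a proper lower semicontinuous $\psi:\mathbb{R}^m\to(-\infty,\infty]$ and $\bar x$ with $\psi(\bar x)<\infty$, the Fréchet subdifferential is $\widehat\partial\psi(\bar x)=\{x^*\in\mathbb{R}^m : \liminf_{x\to\bar x}\frac{\psi(x)-\psi(\bar x)-\langle x^*,x-\bar x\rangle}{\|x-\bar x\|}\ge 0\}$. For a set $\Omega$ and $p\in\Omega$, the Fréchet normal cone is $\widehat N(p;\Omega)=\widehat\partial\delta_\Omega(p)$, where $\delta_\Omega$ equals $0$ on $\Omega$ and $\infty$ elsewhere. Fréchet second-order subdifferential of a $\mathcal{C}^{1,1}$-smooth $\varphi$: it is the Fréchet coderivative of the gradient mapping, i.e. for $x,u\in\mathbb{R}^n$, $\widehat\partial^2\varphi(x)(u)=\{z\in\mathbb{R}^n : (z,-u)\in\widehat N((x,\nabla\varphi(x));\mathrm{gph}\,\nabla\varphi)\}$,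 where $\mathrm{gph}\,\nabla\varphi=\{(y,\nabla\varphi(y)) : y\in\mathbb{R}^n\}\subset\mathbb{R}^n\times\mathbb{R}^n$. This set may be empty. *)

theory Defs
  imports "HOL-Analysis.Analysis"
begin

definition grad :: "('a::euclidean_space \<Rightarrow> real) \<Rightarrow> 'a \<Rightarrow> 'a" where
  "grad f x = (THE D. GDERIV f x :> D)"

lemma grad_eqI:
  assumes "GDERIV f x :> D"
  shows "grad f x = D"
  unfolding grad_def
proof (rule the_equality)
  fix E assume "GDERIV f x :> E"
  with assms have "(\<lambda>h. inner h D) = (\<lambda>h. inner h E)"
    unfolding gderiv_def by (rule has_derivative_unique)
  then show "E = D"
    by (metis vector_eq_ldot)
qed (rule assms)

lemma differentiable_imp_GDERIV_grad:
  fixes f :: "'a::euclidean_space \<Rightarrow> real"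
  assumes "f differentiable (at x)"
  shows "GDERIV f x :> grad f x"
proof -
  obtain f' where f': "(f has_derivative f') (at x)"
    using assms by (auto simp: differentiable_def)
  then have "linear f'"
    by (rule has_derivative_linear)
  then have "f' = (\<lambda>h. inner h (adjoint f' 1))"
    by (simp add: adjoint_works)
  with f' have "GDERIV f x :> adjoint f' 1"
    by (simp add: gderiv_def)
  then show ?thesis
    by (simp add: grad_eqI)
qed

definition locally_lipschitz :: "('a::metric_space \<Rightarrow> 'b::metric_space) \<Rightarrow> bool" where
  "locally_lipschitz F \<longleftrightarrow> (\<forall>x. \<exists>r>0. \<exists>L. L-lipschitz_on (ball x r) F)"

definition C11_smooth :: "('a::euclidean_space \<Rightarrow> real) \<Rightarrow> bool" where
  "C11_smooth f \<longleftrightarrow> (\<forall>x. f differentiable (at x)) \<and> locally_lipschitz (grad f)"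

text \<open>Meaningful for differentiable functions only.\<close>

definition pseudoconvex :: "('a::euclidean_space \<Rightarrow> real) \<Rightarrow> bool" where
  "pseudoconvex f \<longleftrightarrow> (\<forall>x y. f x > f y \<longrightarrow> inner (grad f x) (y - x) < 0)"

text \<open>
  By convention the subdifferential is empty at points where the function is not finite.
  The filter \<open>at x\<close> excludes \<open>x\<close> itself, so the quotient is never taken with denominator 0.
\<close>

definition frechet_subdiff :: "('a::euclidean_space \<Rightarrow> ereal) \<Rightarrow> 'a \<Rightarrow> 'a set" where
  "frechet_subdiff \<psi> x = {v. \<bar>\<psi> x\<bar> \<noteq> \<infinity> \<and>
     Liminf (at x) (\<lambda>y. (\<psi> y - \<psi> x - ereal (inner v (y - x))) / ereal (norm (y - x))) \<ge> 0}"

definition set_indicator :: "'a set \<Rightarrow> 'a \<Rightarrow> ereal" where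
  "set_indicator \<Omega> x = (if x \<in> \<Omega> then 0 else \<infinity>)"

definition frechet_normal_cone :: "'a::euclidean_space \<Rightarrow> 'a set \<Rightarrow> 'a set" where
  "frechet_normal_cone p \<Omega> = frechet_subdiff (set_indicator \<Omega>) p"

definition gph :: "('a \<Rightarrow> 'b) \<Rightarrow> ('a \<times> 'b) set" where
  "gph F = {(y, F y) | y. True}"

definition frechet_coderivative ::
  "('a::euclidean_space \<Rightarrow> 'b::euclidean_space) \<Rightarrow> 'a \<Rightarrow> 'b \<Rightarrow> 'a set" where
  "frechet_coderivative F x u = {z. (z, - u) \<in> frechet_normal_cone (x, F x) (gph F)}"

definition frechet_subdiff2 :: "('a::euclidean_space \<Rightarrow> real) \<Rightarrow> 'a \<Rightarrow> 'a \<Rightarrow> 'a set" where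
  "frechet_subdiff2 f x u = frechet_coderivative (grad f) x u"

end

theory Submission
  imports Defs
begin

text \<open>
  Write \<open>g y = inner u (grad \<phi> y)\<close>, so that \<open>g x = 0\<close>. Since the gradient is Lipschitz near \<open>x\<close>,
  the coderivative condition on \<open>z\<close> says that \<open>g y \<ge> inner z (y - x) - o(norm (y - x))\<close>. If
  \<open>inner z u < 0\<close>, taking \<open>y = x - t *\<^sub>R u\<close> gives \<open>g (x - t *\<^sub>R u) > 0\<close> for all small \<open>t > 0\<close>,
  whence \<open>\<phi> (x - t *\<^sub>R u) < \<phi> x\<close> by the mean value theorem. Pseudoconvexity then forces
  \<open>inner (grad \<phi> x) (- t *\<^sub>R u) < 0\<close>, contradicting \<open>inner (grad \<phi> x) u = 0\<close>.
\<close>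

text \<open>On \<open>\<Omega>\<close> both indicator values vanish, so the quotient is
  \<open>- inner v (y - p) / norm (y - p)\<close>; its lower limit being at least 0 makes it
  eventually exceed \<open>- e\<close>.\<close>

lemma frechet_normal_cone_eventually:
  assumes v: "v \<in> frechet_normal_cone p \<Omega>" and e: "e > 0"
  shows "\<forall>\<^sub>F y in at p within \<Omega>. inner v (y - p) < e * norm (y - p)"
proof -
  \<comment> \<open>The finiteness clause of \<open>frechet_subdiff\<close> rules out base points
    where the indicator is infinite.\<close>
  have p: "p \<in> \<Omega>"
    using v by (auto simp: frechet_normal_cone_def frechet_subdiff_def set_indicator_def split: if_splits)
  let ?q = "\<lambda>y. (set_indicator \<Omega> y - set_indicator \<Omega> p - ereal (inner v (y - p))) / ereal (norm (y - p))"
  have "ereal (- e) < Liminf (at p) ?q"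
    using v e less_le_trans[of "ereal (- e)" 0]
    by (auto simp: frechet_normal_cone_def frechet_subdiff_def)
  then have "\<forall>\<^sub>F y in at p. ereal (- e) < ?q y"
    by (rule less_LiminfD)
  moreover have "inner v (y - p) < e * norm (y - p)"
    if "ereal (- e) < ?q y" "y \<noteq> p" "y \<in> \<Omega>" for y
  proof -
    have "- e < - inner v (y - p) / norm (y - p)"
      using that p by (simp add: set_indicator_def)
    then show ?thesis
      using that by (simp add: field_simps)
  qed
  ultimately show ?thesis
    by (auto simp: eventually_at_filter elim: eventually_mono)
qed

text \<open>The Lipschitz bound makes a displacement along the graph at most \<open>1 + L\<close>
  times \<open>norm (y - x)\<close>, so the error can be measured in \<open>y - x\<close> alone;
  hence the tolerance \<open>d = e / (1 + L)\<close> on the graph.\<close>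

lemma frechet_coderivative_eventually:
  assumes z: "z \<in> frechet_coderivative F x u"
    and L: "r > 0" "L-lipschitz_on (ball x r) F"
    and e: "e > 0"
  shows "\<forall>\<^sub>F y in at x. inner z (y - x) - inner u (F y - F x) < e * norm (y - x)"
proof -
  have L0: "L \<ge> 0"
    using L by (rule_tac lipschitz_on_nonneg)
  define d where "d = e / (1 + L)"
  have d: "d > 0" "d * (1 + L) = e"
    using e L0 by (auto simp: d_def)
  have "continuous (at x) F"
    using lipschitz_on_continuous_on[OF L(2)] L(1)
    by (simp add: continuous_on_eq_continuous_at)
  then have "((\<lambda>y. (y, F y)) \<longlongrightarrow> (x, F x)) (at x)"
    by (intro tendsto_intros) (simp add: continuous_at)
  \<comment> \<open>The punctured filter is respected: distinct \<open>y\<close> and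
    \<open>x\<close> give distinct graph points.\<close>
  then have "filterlim (\<lambda>y. (y, F y)) (at (x, F x) within gph F) (at x)"
    by (auto simp: filterlim_at gph_def eventually_at_filter)
  moreover have "\<forall>\<^sub>F q in at (x, F x) within gph F. 
      inner (z, - u) (q - (x, F x)) < d * norm (q - (x, F x))"
    using z d by (intro frechet_normal_cone_eventually) (auto simp: frechet_coderivative_def)
  ultimately have "\<forall>\<^sub>F y in at x. 
      inner (z, - u) ((y, F y) - (x, F x)) < d * norm ((y, F y) - (x, F x))"
    by (rule filterlim_iff[THEN iffD1, rule_format])
  moreover have "\<forall>\<^sub>F y in at x. y \<in> ball x r"
    using L(1) by (intro eventually_at_in_open') auto
  ultimately show ?thesis
  proof eventually_elim
    case (elim y)
    have "norm ((y, F y) - (x, F x)) \<le> norm (y - x) + norm (F y - F x)"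
      by (simp add: norm_Pair sqrt_sum_squares_le_sum)
    also have "norm (F y - F x) \<le> L * norm (y - x)"
      using lipschitz_onD[OF L(2), of y x] elim L(1) by (simp add: dist_norm)
    finally have "d * norm ((y, F y) - (x, F x)) \<le> d * ((1 + L) * norm (y - x))"
      using d(1) by (intro mult_left_mono) (auto simp: algebra_simps)
    also have "\<dots> = e * norm (y - x)"
      using d by (simp flip: mult.assoc)
    finally show ?case
      using elim by simp
  qed
qed

lemma pseudoconvex_frechet_subdiff2_nonneg:
  fixes f :: "'a::euclidean_space \<Rightarrow> real"
  assumes f: "C11_smooth f" "pseudoconvex f"
    and u: "inner (grad f x) u = 0"
    and z: "z \<in> frechet_subdiff2 f x u"
  shows "inner z u \<ge> 0"
proof (rule ccontr)
  assume "\<not> inner z u \<ge> 0"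
  then have neg: "inner z u < 0" and u0: "u \<noteq> 0"
    by auto
  obtain r L where L: "r > 0" "L-lipschitz_on (ball x r) (grad f)"
    using f unfolding C11_smooth_def locally_lipschitz_def by blast
  \<comment> \<open>With this \<open>e\<close> and \<open>y = x - t *\<^sub>R u\<close>, the error
    \<open>e * norm (y - x)\<close> equals \<open>inner z (y - x)\<close> exactly. The two cancel,
    and the strict inequality leaves a positive directional derivative.\<close>
  define e where "e = - inner z u / norm u"
  have e: "e > 0" "e * norm u = - inner z u"
    using neg u0 by (auto simp: e_def divide_neg_pos)
  have "\<forall>\<^sub>F y in at x. inner z (y - x) - inner u (grad f y - grad f x) < e * norm (y - x)"
    using z L e by (intro frechet_coderivative_eventually) (auto simp: frechet_subdiff2_def)
  \<comment> \<open>As \<open>u \<noteq> 0\<close>, the ray avoids \<open>x\<close> for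
    \<open>t > 0\<close>, as the punctured filter requires.\<close>
  moreover have "filterlim (\<lambda>t. x - t *\<^sub>R u) (at x) (at_right 0)"
  proof -
    have "((\<lambda>t. x - t *\<^sub>R u) \<longlongrightarrow> x - 0 *\<^sub>R u) (at_right 0)"
      by (intro tendsto_intros)
    then show ?thesis
      using u0 by (auto simp: filterlim_at eventually_at_filter)
  qed
  ultimately have "\<forall>\<^sub>F t in at_right 0. inner z ((x - t *\<^sub>R u) - x)
      - inner u (grad f (x - t *\<^sub>R u) - grad f x) < e * norm ((x - t *\<^sub>R u) - x)"
    by (rule filterlim_iff[THEN iffD1, rule_format, rotated])
  then have "\<forall>\<^sub>F t in at_right 0. inner (grad f (x - t *\<^sub>R u)) u > 0"
    using eventually_at_right_less
  proof eventually_elim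
    case (elim t)
    have "e * norm ((x - t *\<^sub>R u) - x) = t * (e * norm u)"
      using elim(2) by simp
    then show ?case
      using elim(1) e(2) u by (simp add: inner_diff_right inner_commute)
  qed
  then obtain b where b: "b > 0" "\<And>t. 0 < t \<Longrightarrow> t < b \<Longrightarrow> inner (grad f (x - t *\<^sub>R u)) u > 0"
    by (auto simp: eventually_at_right_field)
  define s where "s = b / 2"
  have s: "0 < s" "s < b"
    using b by (auto simp: s_def)
  have deriv: "((\<lambda>t. f (x - t *\<^sub>R u)) has_real_derivative - inner (grad f (x - t *\<^sub>R u)) u) (at t)" for t
  proof -
    have "(f has_derivative (\<lambda>h. inner h (grad f (x - t *\<^sub>R u)))) (at (x - t *\<^sub>R u))"
      using f differentiable_imp_GDERIV_grad by (auto simp: C11_smooth_def gderiv_def)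
    moreover have "((\<lambda>t. x - t *\<^sub>R u) has_derivative (\<lambda>h. - (h *\<^sub>R u))) (at t)"
      by (auto intro!: derivative_eq_intros)
    ultimately have "((\<lambda>t. f (x - t *\<^sub>R u)) has_derivative
        (\<lambda>h. inner (- (h *\<^sub>R u)) (grad f (x - t *\<^sub>R u)))) (at t)"
      by (rule has_derivative_compose[rotated])
    then show ?thesis
      unfolding has_field_derivative_def
      by (rule has_derivative_eq_rhs) (auto simp: inner_commute)
  qed
  \<comment> \<open>The intermediate point satisfies \<open>0 < t\<close> and
    \<open>t < s < b\<close>, where the derivative is known to be negative.\<close>
  obtain t where t: "0 < t" "t < s" "f (x - s *\<^sub>R u) - f (x - 0 *\<^sub>R u)
      = (s - 0) * - inner (grad f (x - t *\<^sub>R u)) u"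
    using MVT2[OF s(1) deriv] by blast
  have "s * inner (grad f (x - t *\<^sub>R u)) u > 0"
    using t b s by simp
  then have "f x > f (x - s *\<^sub>R u)"
    using t(3) by simp
  then have "inner (grad f x) ((x - s *\<^sub>R u) - x) < 0"
    using f(2) unfolding pseudoconvex_def by blast
  then show False
    using u by simp
qed

theorem theorem3p3:
  fixes \<phi> :: "real ^ 'n \<Rightarrow> real"
  assumes "C11_smooth \<phi>"
    and "pseudoconvex \<phi>"
  shows "\<forall>x u. inner (grad \<phi> x) u = 0 \<longrightarrow> (\<forall>z \<in> frechet_subdiff2 \<phi> x u. inner z u \<ge> 0)"
  using pseudoconvex_frechet_subdiff2_nonneg[OF assms] by blast

end
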